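(* Let $S$ be a convex subset of a real vector space with $\operatorname{icr}S\neq\emptyset$, let $\varphi:S\to\mathbb{R}$ be convex, let $x_0\in\operatorname{icr}S$, let $A\ge\varphi(x_0)$ be a real number, and let $C_A$, $\mu$, $X_A$ be as defined in the context, with $C_A-x_0=-(C_A-x_0)$. For $x\in\operatorname{icr}S$ put $$\partial^\mu_C\varphi(x)=\{\zeta\in X_A':\varphi'(x,v)\ge\langle\zeta,v\rangle\text{ for all }v\in X_A\}.$$ Then $\partial^\mu_C\varphi(x)$ is non-empty and convex for every $x\in\operatorname{icr}S$. If additionally the space $X_A$ is supplied with a vector topology such that $\mu$ is continuous, then $\partial^\mu_C\varphi(x)\subset X_A^*$ for every $x\in\operatorname{icr}S$ and $\partial^\mu_C\varphi(x)$ is compact with respect to the topology $\sigma(X_A^*,X_A)$.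
   Context: $\operatorname{icr}S=\{x\in S:\text{ for every }y\in\operatorname{span}(S-S)\text{ there is }t>0\text{ with }x+ty\in S\}$, where $S-S=\{a-b:a,b\in S\}$. Put $S_A:=\{x\in S:\varphi(x)\le A\}$, $$C_A:=\{x\in S_A:\exists\,\alpha>0\text{ such that }x_0+\alpha(x-x_0)\in S_A\text{ and }x_0-\alpha(x-x_0)\in S_A\},$$ $X_A:=\operatorname{span}(C_A-x_0)$, and let $\mu(v)=\inf\{t>0:v\in t(C_A-x_0)\}$ be the Minkowski functional of $C_A-x_0$. $X_A'$ is the algebraic dual, $X_A^*$ the topological dual, $\sigma(X_A^*,X_A)$ the topology of pointwise convergence on $X_A$. The directional derivative is $\varphi'(x,v)=\lim_{t\to0+}\frac{\varphi(x+tv)-\varphi(x)}{t}$. *)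

theory Defs
  imports "HOL-Analysis.Analysis"
begin

definition icr :: "'a::real_vector set \<Rightarrow> 'a set" where
  "icr S = {x \<in> S. \<forall>y \<in> span {a - b |a b. a \<in> S \<and> b \<in> S}. \<exists>t>0. x + t *\<^sub>R y \<in> S}"

text \<open>
  A function \<open>\<phi> : S \<rightarrow> \<real>\<close> is represented by a total function whose values outside \<open>S\<close>
  are irrelevant.
\<close>

definition sublevel :: "'a::real_vector set \<Rightarrow> ('a \<Rightarrow> real) \<Rightarrow> real \<Rightarrow> 'a set" where
  "sublevel S \<phi> A = {x \<in> S. \<phi> x \<le> A}"

definition C_set :: "'a::real_vector set \<Rightarrow> ('a \<Rightarrow> real) \<Rightarrow> 'a \<Rightarrow> real \<Rightarrow> 'a set" where
  "C_set S \<phi> x0 A = {x \<in> sublevel S \<phi> A. \<exists>\<alpha>>0.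
      x0 + \<alpha> *\<^sub>R (x - x0) \<in> sublevel S \<phi> A \<and> x0 - \<alpha> *\<^sub>R (x - x0) \<in> sublevel S \<phi> A}"

definition C_shift :: "'a::real_vector set \<Rightarrow> ('a \<Rightarrow> real) \<Rightarrow> 'a \<Rightarrow> real \<Rightarrow> 'a set" where
  "C_shift S \<phi> x0 A = (\<lambda>x. x - x0) ` C_set S \<phi> x0 A"

definition X_space :: "'a::real_vector set \<Rightarrow> ('a \<Rightarrow> real) \<Rightarrow> 'a \<Rightarrow> real \<Rightarrow> 'a set" where
  "X_space S \<phi> x0 A = span (C_shift S \<phi> x0 A)"

definition minkowski_functional :: "'a::real_vector set \<Rightarrow> 'a \<Rightarrow> real" where
  "minkowski_functional K v = Inf {t. t > 0 \<and> v \<in> (\<lambda>k. t *\<^sub>R k) ` K}"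

text \<open>
  For \<open>\<phi>\<close> convex on \<open>S\<close>, \<open>x \<in> icr S\<close> and \<open>v \<in> span (S - S)\<close>, the points \<open>x + t v\<close> with small
  \<open>t > 0\<close> lie in \<open>S\<close>, the limit exists in \<open>\<real>\<close>, and it depends only on the values of \<open>\<phi>\<close> on \<open>S\<close>.
\<close>

definition dir_deriv :: "('a::real_vector \<Rightarrow> real) \<Rightarrow> 'a \<Rightarrow> 'a \<Rightarrow> real" where
  "dir_deriv \<phi> x v = Lim (at_right 0) (\<lambda>t. (\<phi> (x + t *\<^sub>R v) - \<phi> x) / t)"

text \<open>
  A functional on a subspace \<open>V\<close> is encoded as an extensional function on \<open>V\<close>, so that equality of
  encodings is equality of functionals on \<open>V\<close>, and the topology of pointwise convergence is
  a subspace of the product topology over the index set \<open>V\<close>.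
\<close>

definition algebraic_dual :: "'a::real_vector set \<Rightarrow> ('a \<Rightarrow> real) set" where
  "algebraic_dual V = {\<zeta> \<in> extensional V.
      (\<forall>u\<in>V. \<forall>v\<in>V. \<zeta> (u + v) = \<zeta> u + \<zeta> v) \<and> (\<forall>c. \<forall>v\<in>V. \<zeta> (c *\<^sub>R v) = c * \<zeta> v)}"

definition convex_functionals :: "'a::real_vector set \<Rightarrow> ('a \<Rightarrow> real) set \<Rightarrow> bool" where
  "convex_functionals V F \<longleftrightarrow> (\<forall>\<zeta>\<in>F. \<forall>\<eta>\<in>F. \<forall>s\<ge>0. \<forall>t\<ge>0. s + t = 1 \<longrightarrow>
      (\<lambda>v\<in>V. s * \<zeta> v + t * \<eta> v) \<in> F)"

text \<open>The Hausdorff property is not part of the notion of a vector topology used here.\<close>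

definition vector_topology_on :: "'a::real_vector set \<Rightarrow> 'a topology \<Rightarrow> bool" where
  "vector_topology_on V T \<longleftrightarrow> subspace V \<and> topspace T = V \<and>
      continuous_map (prod_topology T T) T (\<lambda>(u, v). u + v) \<and>
      continuous_map (prod_topology euclideanreal T) T (\<lambda>(c, v). c *\<^sub>R v)"

definition topological_dual :: "'a::real_vector topology \<Rightarrow> ('a \<Rightarrow> real) set" where
  "topological_dual T = {\<zeta> \<in> algebraic_dual (topspace T). continuous_map T euclideanreal \<zeta>}"

definition weak_star_topology :: "'a::real_vector topology \<Rightarrow> ('a \<Rightarrow> real) topology" where
  "weak_star_topology T =
     subtopology (product_topology (\<lambda>_. euclideanreal) (topspace T)) (topological_dual T)"

definition mu_subdifferential ::
    "'a::real_vector set \<Rightarrow> ('a \<Rightarrow> real) \<Rightarrow> 'a \<Rightarrow> real \<Rightarrow> 'a \<Rightarrow> ('a \<Rightarrow> real) set" where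
  "mu_subdifferential S \<phi> x0 A x =
     {\<zeta> \<in> algebraic_dual (X_space S \<phi> x0 A). \<forall>v \<in> X_space S \<phi> x0 A. dir_deriv \<phi> x v \<ge> \<zeta> v}"

end

theory Submission
  imports Defs
begin

text \<open>
  A point \<open>x\<close> of \<open>icr S\<close> is a proper convex combination of \<open>x0\<close> and some \<open>z \<in> S\<close>, so a small copy
  of \<open>C_A - x0\<close> centred at \<open>x\<close> lies in \<open>S\<close> and \<open>\<phi>\<close> is bounded above on it. Hence the sublinear
  functional \<open>\<phi>'(x, \<sqdot>)\<close> is bounded by a multiple of \<open>\<mu>\<close>. The Hahn-Banach theorem gives
  non-emptiness; the bound by \<open>\<mu>\<close> gives continuity of subgradients and, with Tychonoff's theorem,
  compactness.
\<close>

section \<open>The Hahn-Banach theorem\<close>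

text \<open>Homogeneity is asked for positive factors only; the value 0 at the origin is then
  forced, because \<open>p 0 = 2 * p 0\<close>.\<close>

definition sublinear :: "('a::real_vector \<Rightarrow> real) \<Rightarrow> bool" where
  "sublinear p \<longleftrightarrow> (\<forall>u v. p (u + v) \<le> p u + p v) \<and> (\<forall>t>0. \<forall>v. p (t *\<^sub>R v) = t * p v)"

lemma sublinear_add: "sublinear p \<Longrightarrow> p (u + v) \<le> p u + p v"
  and sublinear_scale: "sublinear p \<Longrightarrow> t > 0 \<Longrightarrow> p (t *\<^sub>R v) = t * p v"
  by (auto simp: sublinear_def)

lemma sublinear_zero: "sublinear p \<Longrightarrow> p 0 = 0"
  using sublinear_scale[of p 2 0] by simp

lemma sublinear_minus_le: "sublinear p \<Longrightarrow> - p (- v) \<le> p v"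
  using sublinear_add[of p v "- v"] sublinear_zero[of p] by simp

text \<open>Serves two infima: over a real parameter in the minimality argument, and over a chain in
  the application of Zorn's lemma. An index \<open>k\<close> depending on the data is enough, since
  each value at \<open>k\<close> bounds the infimum from above.\<close>

lemma sublinear_INF:
  fixes f :: "'i \<Rightarrow> 'a::real_vector \<Rightarrow> real"
  assumes "I \<noteq> {}"
    and bdd: "\<And>v. bdd_below ((\<lambda>i. f i v) ` I)"
    and add: "\<And>i j v w. i \<in> I \<Longrightarrow> j \<in> I \<Longrightarrow> \<exists>k\<in>I. f k (v + w) \<le> f i v + f j w"
    and scale: "\<And>i s v. i \<in> I \<Longrightarrow> s > 0 \<Longrightarrow> \<exists>k\<in>I. f k (s *\<^sub>R v) \<le> s * f i v"
  shows "sublinear (\<lambda>v. INF i\<in>I. f i v)"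
proof -
  let ?r = "\<lambda>v. INF i\<in>I. f i v"
  have le: "?r (s *\<^sub>R v) \<le> s * ?r v" if "s > 0" for s v
  proof -
    have "?r (s *\<^sub>R v) / s \<le> ?r v"
    proof (rule cINF_greatest[OF \<open>I \<noteq> {}\<close>])
      fix i assume "i \<in> I"
      then obtain k where "k \<in> I" "f k (s *\<^sub>R v) \<le> s * f i v"
        using scale \<open>s > 0\<close> by blast
      then have "?r (s *\<^sub>R v) \<le> s * f i v"
        using cINF_lower2[OF bdd] by blast
      then show "?r (s *\<^sub>R v) / s \<le> f i v"
        using \<open>s > 0\<close> by (simp add: field_simps)
    qed
    then show ?thesis using \<open>s > 0\<close> by (simp add: field_simps)
  qed
  have "?r (s *\<^sub>R v) = s * ?r v" if "s > 0" for s v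
  proof (rule antisym[OF le[OF that]])
    \<comment> \<open>The reverse inequality is the one already proved, applied with the factor
      \<open>inverse s\<close> to the vector \<open>s *\<^sub>R v\<close>.\<close>
    have "?r (inverse s *\<^sub>R (s *\<^sub>R v)) \<le> inverse s * ?r (s *\<^sub>R v)"
      using le[of "inverse s" "s *\<^sub>R v"] that by simp
    then show "s * ?r v \<le> ?r (s *\<^sub>R v)"
      using that by (simp add: field_simps)
  qed
  moreover have "?r (v + w) \<le> ?r v + ?r w" for v w
  proof -
    have "?r (v + w) - ?r v \<le> ?r w"
    proof (rule cINF_greatest[OF \<open>I \<noteq> {}\<close>])
      fix j assume "j \<in> I"
      have "?r (v + w) - f j w \<le> ?r v"
      proof (rule cINF_greatest[OF \<open>I \<noteq> {}\<close>])
        fix i assume "i \<in> I"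
        then obtain k where "k \<in> I" "f k (v + w) \<le> f i v + f j w"
          using add \<open>j \<in> I\<close> by blast
        then have "?r (v + w) \<le> f i v + f j w"
          using cINF_lower2[OF bdd] by blast
        then show "?r (v + w) - f j w \<le> f i v" by simp
      qed
      then show "?r (v + w) - ?r v \<le> f j w" by simp
    qed
    then show ?thesis by simp
  qed
  ultimately show ?thesis by (simp add: sublinear_def)
qed

text \<open>
  For a minimal \<open>q\<close> the sublinear functional \<open>v \<mapsto> inf\<^sub>t\<^sub>\<ge>\<^sub>0 q (v + t u) - t q u\<close>, which lies below \<open>q\<close>,
  must be \<open>q\<close> itself; the value \<open>t = 1\<close> then yields superadditivity.
\<close>

lemma minimal_sublinear_imp_linear:
  fixes q :: "'a::real_vector \<Rightarrow> real"
  assumes q: "sublinear q"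
    and min: "\<And>r. sublinear r \<Longrightarrow> r \<le> q \<Longrightarrow> r = q"
  shows "linear q"
proof -
  have super: "q u + q v \<le> q (u + v)" for u v
  proof -
    define f where "f = (\<lambda>t v. q (v + t *\<^sub>R u) - t * q u)"
    define r where "r = (\<lambda>v. INF t\<in>{0..}. f t v)"
    \<comment> \<open>The bound is uniform in \<open>t\<close>: subadditivity gives \<open>t * q u =
      q (t *\<^sub>R u) \<le> q (w + t *\<^sub>R u) + q (- w)\<close>.\<close>
    have bdd: "bdd_below ((\<lambda>t. f t w) ` {0..})" for w
    proof (rule bdd_belowI2)
      fix t :: real assume "t \<in> {0..}"
      then have "q (t *\<^sub>R u) = t * q u"
        using q by (cases "t = 0") (auto simp: sublinear_zero sublinear_scale)
      then show "- q (- w) \<le> f t w"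
        using sublinear_add[OF q, of "w + t *\<^sub>R u" "- w"] by (simp add: f_def)
    qed
    have "sublinear r"
      unfolding r_def
    proof (rule sublinear_INF[OF _ bdd])
      fix i j :: real and v w assume ij: "i \<in> {0..}" "j \<in> {0..}"
      have "f (i + j) (v + w) \<le> f i v + f j w"
        using sublinear_add[OF q, of "v + i *\<^sub>R u" "w + j *\<^sub>R u"]
        by (simp add: f_def algebra_simps)
      with ij show "\<exists>k\<in>{0..}. f k (v + w) \<le> f i v + f j w"
        by (intro bexI[of _ "i + j"]) auto
    next
      fix i s :: real and v assume is_nonneg: "i \<in> {0..}" "s > 0"
      have "f (s * i) (s *\<^sub>R v) = s * f i v"
        using sublinear_scale[OF q \<open>s > 0\<close>, of "v + i *\<^sub>R u"]
        by (simp add: f_def algebra_simps)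
      with is_nonneg show "\<exists>k\<in>{0..}. f k (s *\<^sub>R v) \<le> s * f i v"
        by (intro bexI[of _ "s * i"]) auto
    qed auto
    moreover have "r \<le> q"
    proof (rule le_funI)
      \<comment> \<open>The parameter 0 gives \<open>f 0 w = q w\<close>.\<close>
      fix w show "r w \<le> q w"
        using cINF_lower[OF bdd, of 0 w] by (simp add: r_def f_def)
    qed
    ultimately have "r = q" by (rule min)
    moreover have "r v \<le> f 1 v"
      unfolding r_def by (rule cINF_lower[OF bdd]) simp
    ultimately show ?thesis by (simp add: f_def add.commute)
  qed
  have add: "q (u + v) = q u + q v" for u v
    using super sublinear_add[OF q] by (intro antisym)
  then have minus: "q (- v) = - q v" for v
    using add[of v "- v"] sublinear_zero[OF q] by simp
  show ?thesis
  proof (rule linearI)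
    fix c :: real and v
    \<comment> \<open>Negative factors are reduced to positive ones by the oddness
      \<open>minus\<close>, a consequence of additivity.\<close>
    consider "c > 0" | "c = 0" | "- c > 0" by linarith
    then show "q (c *\<^sub>R v) = c *\<^sub>R q v"
    proof cases
      case 3
      then have "q (- c *\<^sub>R v) = - c * q v" by (rule sublinear_scale[OF q])
      then show ?thesis using minus[of "c *\<^sub>R v"] by simp
    qed (use q in \<open>auto simp: sublinear_zero sublinear_scale\<close>)
  qed (rule add)
qed

text \<open>Zorn's lemma yields a minimal element among the sublinear functionals below
  \<open>p\<close>, and minimal ones are linear.\<close>

lemma sublinear_dominates_linear:
  fixes p :: "'a::real_vector \<Rightarrow> real"
  assumes p: "sublinear p"
  obtains f where "linear f" "f \<le> p"
proof -
  define Q where "Q = {q. sublinear q \<and> q \<le> p}"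
  have "\<exists>m\<in>Q. \<forall>q\<in>Q. q \<le> m \<longrightarrow> q = m"
  proof (rule predicate_Zorn)
    \<comment> \<open>The order is reversed, so that the maximal element supplied by Zorn's lemma is
      minimal for the pointwise order.\<close>
    show "partial_order_on Q (relation_of (\<lambda>q q'. q' \<le> q) Q)"
      by (rule partial_order_on_relation_ofI) auto
  next
    fix \<C> assume C: "\<C> \<in> Chains (relation_of (\<lambda>q q'. q' \<le> q) Q)"
    then have CQ: "\<C> \<subseteq> Q" by (auto simp: Chains_def relation_of_def)
    show "\<exists>u\<in>Q. \<forall>q\<in>\<C>. u \<le> q"
    proof (cases "\<C> = {}")
      case True
      then show ?thesis using p by (auto simp: Q_def)
    next
      case False
      define r where "r = (\<lambda>v. INF q\<in>\<C>. q v)"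
      \<comment> \<open>All members of the chain share a lower bound:
        \<open>- p (- v) \<le> - q (- v) \<le> q v\<close>.\<close>
      have bdd: "bdd_below ((\<lambda>q. q v) ` \<C>)" for v
      proof (rule bdd_belowI2)
        fix q assume "q \<in> \<C>"
        then have "sublinear q" "q (- v) \<le> p (- v)"
          using CQ by (auto simp: Q_def le_fun_def)
        then show "- p (- v) \<le> q v"
          using sublinear_minus_le[of q v] by simp
      qed
      have "sublinear r"
        unfolding r_def
      proof (rule sublinear_INF[OF False bdd])
        fix q q' v w assume qq: "q \<in> \<C>" "q' \<in> \<C>"
        then have sub: "sublinear q" "sublinear q'" using CQ by (auto simp: Q_def)
        \<comment> \<open>The smaller of two comparable functionals serves as the common
          index.\<close>
        from C qq consider "q \<le> q'" | "q' \<le> q"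
          by (auto simp: Chains_def relation_of_def)
        then show "\<exists>k\<in>\<C>. k (v + w) \<le> q v + q' w"
        proof cases
          case 1
          then have "q (v + w) \<le> q v + q' w"
            using sublinear_add[OF sub(1), of v w] by (auto simp: le_fun_def intro: order_trans)
          then show ?thesis using qq by blast
        next
          case 2
          then have "q' (v + w) \<le> q v + q' w"
            using sublinear_add[OF sub(2), of v w] by (auto simp: le_fun_def intro: order_trans)
          then show ?thesis using qq by blast
        qed
      next
        fix q s v assume "q \<in> \<C>" "(s::real) > 0"
        then show "\<exists>k\<in>\<C>. k (s *\<^sub>R v) \<le> s * q v"
          using CQ by (intro bexI[of _ q]) (auto simp: Q_def sublinear_scale)
      qed
      moreover have low: "r \<le> q" if "q \<in> \<C>" for q
        unfolding r_def by (intro le_funI cINF_lower[OF bdd] that)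
      moreover have "r \<le> p"
      proof -
        from False obtain q where "q \<in> \<C>" by blast
        then have "r \<le> q" "q \<le> p" using low CQ by (auto simp: Q_def)
        then show ?thesis by (rule order_trans)
      qed
      ultimately show ?thesis by (auto simp: Q_def)
    qed
  qed
  then obtain m where m: "m \<in> Q" "\<And>q. q \<in> Q \<Longrightarrow> q \<le> m \<Longrightarrow> q = m" by blast
  have "linear m"
  proof (rule minimal_sublinear_imp_linear)
    show "sublinear m" using m(1) by (simp add: Q_def)
    fix r assume "sublinear r" "r \<le> m"
    then show "r = m"
      using m by (auto simp: Q_def intro: order_trans)
  qed
  with m(1) show thesis by (auto simp: Q_def intro: that)
qed

text \<open>Composition with a linear projection onto \<open>V\<close> extends \<open>p\<close> to a
  sublinear functional on the whole space. The linear minorant found there is restricted to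
  \<open>V\<close>, which makes it extensional.\<close>

lemma sublinear_on_dominates_functional:
  fixes p :: "'a::real_vector \<Rightarrow> real"
  assumes V: "subspace V"
    and add: "\<And>u v. u \<in> V \<Longrightarrow> v \<in> V \<Longrightarrow> p (u + v) \<le> p u + p v"
    and scale: "\<And>t v. t > 0 \<Longrightarrow> v \<in> V \<Longrightarrow> p (t *\<^sub>R v) = t * p v"
  obtains \<zeta> where "\<zeta> \<in> algebraic_dual V" "\<And>v. v \<in> V \<Longrightarrow> \<zeta> v \<le> p v"
proof -
  \<comment> \<open>A left inverse of the identity on \<open>V\<close> with range in
    \<open>V\<close> is a projection onto \<open>V\<close>.\<close>
  obtain \<pi> :: "'a \<Rightarrow> 'a" where \<pi>: "range \<pi> \<subseteq> V" "linear \<pi>" "\<And>v. v \<in> V \<Longrightarrow> \<pi> v = v"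
    using linear_exists_left_inverse_on[OF linear_id V] by auto
  have "sublinear (\<lambda>v. p (\<pi> v))"
    using \<pi> add scale by (auto simp: sublinear_def linear_add linear_scale image_subset_iff)
  then obtain f where f: "linear f" "f \<le> (\<lambda>v. p (\<pi> v))"
    by (rule sublinear_dominates_linear)
  show thesis
  proof (rule that[of "restrict f V"])
    show "restrict f V \<in> algebraic_dual V"
      using V f(1) by (auto simp: algebraic_dual_def subspace_add subspace_scale linear_add linear_scale)
    fix v assume "v \<in> V"
    then show "restrict f V v \<le> p v"
      using le_funD[OF f(2), of v] \<pi>(3) by simp
  qed
qed

section \<open>Directional derivatives\<close>

text \<open>The definition of \<open>icr\<close> yields one point in each direction; convexity adds
  the segment leading to it.\<close>

lemma icr_segment:
  assumes "convex S" "x \<in> icr S" "v \<in> span {a - b |a b. a \<in> S \<and> b \<in> S}"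
  obtains d where "d > 0" "\<And>t. 0 \<le> t \<Longrightarrow> t \<le> d \<Longrightarrow> x + t *\<^sub>R v \<in> S"
proof -
  obtain d where d: "d > 0" "x + d *\<^sub>R v \<in> S" and "x \<in> S"
    using assms(2,3) by (auto simp: icr_def)
  have "x + t *\<^sub>R v \<in> S" if "0 \<le> t" "t \<le> d" for t
  proof -
    have "x + t *\<^sub>R v = (1 - t / d) *\<^sub>R x + (t / d) *\<^sub>R (x + d *\<^sub>R v)"
      using d by (simp add: algebra_simps)
    also have "\<dots> \<in> S"
      using that d \<open>x \<in> S\<close> by (intro convexD[OF assms(1)]) auto
    finally show ?thesis .
  qed
  with d(1) show thesis by (rule that)
qed

text \<open>The nearer point divides the segment from \<open>x\<close> to the farther one with
  weight \<open>s / t\<close>.\<close>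

lemma convex_on_difference_quotient_mono:
  assumes "convex_on S \<phi>" "x \<in> S" "x + t *\<^sub>R v \<in> S" "0 < s" "s \<le> t"
  shows "(\<phi> (x + s *\<^sub>R v) - \<phi> x) / s \<le> (\<phi> (x + t *\<^sub>R v) - \<phi> x) / t"
proof -
  have "x + s *\<^sub>R v = (1 - s / t) *\<^sub>R x + (s / t) *\<^sub>R (x + t *\<^sub>R v)"
    using assms by (simp add: algebra_simps)
  then have "\<phi> (x + s *\<^sub>R v) \<le> (1 - s / t) * \<phi> x + (s / t) * \<phi> (x + t *\<^sub>R v)"
    using convex_onD[OF assms(1), of "s / t" x "x + t *\<^sub>R v"] assms by simp
  then have "\<phi> (x + s *\<^sub>R v) - \<phi> x \<le> s * ((\<phi> (x + t *\<^sub>R v) - \<phi> x) / t)"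
    by (simp add: algebra_simps diff_divide_distrib)
  then show ?thesis using assms by (simp add: pos_divide_le_eq mult.commute)
qed

text \<open>Since \<open>x\<close> lies between a point behind it and a point ahead of it, convexity
  bounds all forward quotients from below by one backward quotient, independently of
  \<open>t\<close>.\<close>

lemma convex_on_difference_quotient_lower:
  assumes "convex_on S \<phi>" "x + t *\<^sub>R v \<in> S" "x - d *\<^sub>R v \<in> S" "0 < t" "0 < d"
  shows "- ((\<phi> (x - d *\<^sub>R v) - \<phi> x) / d) \<le> (\<phi> (x + t *\<^sub>R v) - \<phi> x) / t"
proof -
  define l where "l = d / (t + d)"
  have l: "0 \<le> l" "l \<le> 1" "1 - l = t / (t + d)" "l * t = (1 - l) * d"
    using assms by (auto simp: l_def field_simps)
  \<comment> \<open>The identity holds for every weight thanks to the last summand, whose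
    coefficient vanishes for the chosen \<open>l\<close>.\<close>
  have "x = (1 - l) *\<^sub>R (x - d *\<^sub>R v) + l *\<^sub>R (x + t *\<^sub>R v) + ((1 - l) * d - l * t) *\<^sub>R v"
    by (simp add: algebra_simps)
  then have "x = (1 - l) *\<^sub>R (x - d *\<^sub>R v) + l *\<^sub>R (x + t *\<^sub>R v)"
    using l(4) by simp
  then have "\<phi> x \<le> (1 - l) * \<phi> (x - d *\<^sub>R v) + l * \<phi> (x + t *\<^sub>R v)"
    using convex_onD[OF assms(1), of l "x - d *\<^sub>R v" "x + t *\<^sub>R v"] assms l by simp
  then have "0 \<le> (1 - l) * (\<phi> (x - d *\<^sub>R v) - \<phi> x) + l * (\<phi> (x + t *\<^sub>R v) - \<phi> x)"
    by (simp add: algebra_simps)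
  \<comment> \<open>Multiplication by \<open>t + d\<close> turns the weights into \<open>t\<close>
    and \<open>d\<close>.\<close>
  then have "0 \<le> (t + d) * ((1 - l) * (\<phi> (x - d *\<^sub>R v) - \<phi> x) + l * (\<phi> (x + t *\<^sub>R v) - \<phi> x))"
    using assms(4,5) by simp
  also have "\<dots> = ((t + d) * (1 - l)) * (\<phi> (x - d *\<^sub>R v) - \<phi> x) + ((t + d) * l) * (\<phi> (x + t *\<^sub>R v) - \<phi> x)"
    by (simp add: algebra_simps)
  also have "\<dots> = t * (\<phi> (x - d *\<^sub>R v) - \<phi> x) + d * (\<phi> (x + t *\<^sub>R v) - \<phi> x)"
    using assms(4,5) l(3) by (simp add: l_def)
  finally show ?thesis
    using assms(4,5) by (simp add: field_simps)
qed

lemma filterlim_scale_at_right_0: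
  "c > 0 \<Longrightarrow> filterlim (\<lambda>t::real. c * t) (at_right 0) (at_right 0)"
  unfolding filterlim_at
  by (auto intro!: tendsto_eq_intros eventually_at_right_less[THEN eventually_mono])

context
  fixes S :: "'a::real_vector set" and \<phi> :: "'a \<Rightarrow> real" and x :: 'a
  assumes S: "convex S" and \<phi>: "convex_on S \<phi>" and x: "x \<in> icr S"
begin

private abbreviation "D \<equiv> span {a - b |a b. a \<in> S \<and> b \<in> S}"
private abbreviation "quot v t \<equiv> (\<phi> (x + t *\<^sub>R v) - \<phi> x) / t"

private lemma x_mem: "x \<in> S"
  using x by (simp add: icr_def)

text \<open>The quotients decrease as \<open>t\<close> decreases and are bounded below, so they
  converge to their infimum. This gives existence of the limit and the upper bound by every single
  quotient at once.\<close>

lemma difference_quotient_tendsto_dir_deriv: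
  assumes v: "v \<in> D"
  shows "(quot v \<longlongrightarrow> dir_deriv \<phi> x v) (at_right 0)"
    and "\<And>t. 0 < t \<Longrightarrow> x + t *\<^sub>R v \<in> S \<Longrightarrow> dir_deriv \<phi> x v \<le> quot v t"
proof -
  obtain d where d: "d > 0" "\<And>t. 0 \<le> t \<Longrightarrow> t \<le> d \<Longrightarrow> x + t *\<^sub>R v \<in> S"
    using icr_segment[OF S x v] by blast
  \<comment> \<open>The direction \<open>- v\<close> also lies in the span; a point of
    \<open>S\<close> behind \<open>x\<close> provides the lower bound.\<close>
  obtain e where e: "e > 0" "\<And>t. 0 \<le> t \<Longrightarrow> t \<le> e \<Longrightarrow> x + t *\<^sub>R (- v) \<in> S"
    using icr_segment[OF S x span_neg[OF v]] by blast
  \<comment> \<open>All admissible steps are included, not only those up to \<open>d\<close>, so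
    that the second claim covers each of them.\<close>
  define I where "I = {t. 0 < t \<and> x + t *\<^sub>R v \<in> S}"
  have "d \<in> I" using d by (simp add: I_def)
  have bdd: "bdd_below (quot v ` I)"
  proof (rule bdd_belowI2)
    fix t assume "t \<in> I"
    then show "- ((\<phi> (x - e *\<^sub>R v) - \<phi> x) / e) \<le> quot v t"
      using e e(2)[of e] by (intro convex_on_difference_quotient_lower[OF \<phi>]) (auto simp: I_def)
  qed
  define L where "L = (INF t\<in>I. quot v t)"
  have low: "L \<le> quot v t" if "t \<in> I" for t
    unfolding L_def by (rule cINF_lower[OF bdd that])
  have ev: "eventually (\<lambda>t. t \<in> I \<and> t \<le> s) (at_right 0)" if "s > 0" for s
    unfolding eventually_at_right_field
    using that d by (intro exI[of _ "min s d"]) (auto simp: I_def)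
  have lim: "(quot v \<longlongrightarrow> L) (at_right 0)"
  proof (rule order_tendstoI)
    fix a assume "a < L"
    then show "eventually (\<lambda>t. a < quot v t) (at_right 0)"
      using low by (intro eventually_mono[OF ev[OF \<open>d > 0\<close>]]) (auto intro: less_le_trans)
  next
    fix a assume "L < a"
    \<comment> \<open>One quotient below \<open>a\<close> suffices, since by monotonicity all
      quotients with smaller steps are below \<open>a\<close> too.\<close>
    then obtain s where s: "s \<in> I" "quot v s < a"
      using \<open>d \<in> I\<close> cINF_less_iff[OF _ bdd] unfolding L_def by blast
    then have "quot v t < a" if "t \<in> I" "t \<le> s" for t
      using convex_on_difference_quotient_mono[OF \<phi> x_mem, of s v t] that
      by (auto simp: I_def intro: le_less_trans)
    then show "eventually (\<lambda>t. quot v t < a) (at_right 0)"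
      using s by (intro eventually_mono[OF ev[of s]]) (auto simp: I_def)
  qed
  then have "dir_deriv \<phi> x v = L"
    unfolding dir_deriv_def by (intro tendsto_Lim) auto
  with lim low show "(quot v \<longlongrightarrow> dir_deriv \<phi> x v) (at_right 0)"
    and "\<And>t. 0 < t \<Longrightarrow> x + t *\<^sub>R v \<in> S \<Longrightarrow> dir_deriv \<phi> x v \<le> quot v t"
    by (auto simp: I_def)
qed

lemma dir_deriv_scale:
  assumes v: "v \<in> D" and c: "c > 0"
  shows "dir_deriv \<phi> x (c *\<^sub>R v) = c * dir_deriv \<phi> x v"
proof -
  have "((\<lambda>t. c * quot v (c * t)) \<longlongrightarrow> c * dir_deriv \<phi> x v) (at_right 0)"
    by (intro tendsto_mult tendsto_const
        filterlim_compose[OF difference_quotient_tendsto_dir_deriv(1)[OF v] filterlim_scale_at_right_0[OF c]])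
  moreover have "c * quot v (c * t) = quot (c *\<^sub>R v) t" for t
    using c by (simp add: mult.commute)
  ultimately show ?thesis
    using difference_quotient_tendsto_dir_deriv(1)[OF span_scale[OF v]]
    by (intro tendsto_unique[of "at_right 0"]) auto
qed

text \<open>The point \<open>x + t *\<^sub>R (u + v)\<close> is the midpoint of
  \<open>x + (2 * t) *\<^sub>R u\<close> and \<open>x + (2 * t) *\<^sub>R v\<close>. Convexity
  compares the quotients, and the doubled step does not change the limit.\<close>

lemma dir_deriv_add_le:
  assumes u: "u \<in> D" and v: "v \<in> D"
  shows "dir_deriv \<phi> x (u + v) \<le> dir_deriv \<phi> x u + dir_deriv \<phi> x v"
proof (rule tendsto_le[of "at_right (0::real)"])
  show "(quot (u + v) \<longlongrightarrow> dir_deriv \<phi> x (u + v)) (at_right 0)"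
    by (rule difference_quotient_tendsto_dir_deriv(1)[OF span_add[OF u v]])
  have two: "filterlim (\<lambda>t::real. 2 * t) (at_right 0) (at_right 0)"
    by (rule filterlim_scale_at_right_0) simp
  show "((\<lambda>t. quot u (2 * t) + quot v (2 * t)) \<longlongrightarrow> dir_deriv \<phi> x u + dir_deriv \<phi> x v) (at_right 0)"
    by (intro tendsto_add filterlim_compose[OF difference_quotient_tendsto_dir_deriv(1) two] u v)
  obtain d where d: "d > 0" "\<And>t. 0 \<le> t \<Longrightarrow> t \<le> d \<Longrightarrow> x + t *\<^sub>R u \<in> S"
    using icr_segment[OF S x u] by blast
  obtain e where e: "e > 0" "\<And>t. 0 \<le> t \<Longrightarrow> t \<le> e \<Longrightarrow> x + t *\<^sub>R v \<in> S"
    using icr_segment[OF S x v] by blast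
  have "quot (u + v) t \<le> quot u (2 * t) + quot v (2 * t)" if t: "0 < t" "t < min d e / 2" for t
  proof -
    have "(1 - 1/2) *\<^sub>R (x + (2 * t) *\<^sub>R u) + (1/2) *\<^sub>R (x + (2 * t) *\<^sub>R v) = (1/2 + 1/2) *\<^sub>R x + t *\<^sub>R (u + v)"
      unfolding scaleR_left_distrib by (simp add: algebra_simps)
    then have "x + t *\<^sub>R (u + v) = (1 - 1/2) *\<^sub>R (x + (2 * t) *\<^sub>R u) + (1/2) *\<^sub>R (x + (2 * t) *\<^sub>R v)"
      by simp
    then have "\<phi> (x + t *\<^sub>R (u + v)) \<le> (1 - 1/2) * \<phi> (x + (2 * t) *\<^sub>R u) + (1/2) * \<phi> (x + (2 * t) *\<^sub>R v)"
      using t d(2)[of "2 * t"] e(2)[of "2 * t"]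
        convex_onD[OF \<phi>, of "1/2" "x + (2 * t) *\<^sub>R u" "x + (2 * t) *\<^sub>R v"] by simp
    then have "2 * (\<phi> (x + t *\<^sub>R (u + v)) - \<phi> x) \<le> (\<phi> (x + (2 * t) *\<^sub>R u) - \<phi> x) + (\<phi> (x + (2 * t) *\<^sub>R v) - \<phi> x)"
      by simp
    from divide_right_mono[OF this, of "2 * t"] t(1) show ?thesis
      by (simp only: add_divide_distrib mult_divide_mult_cancel_left)
  qed
  then show "eventually (\<lambda>t. quot (u + v) t \<le> quot u (2 * t) + quot v (2 * t)) (at_right 0)"
    unfolding eventually_at_right_field using d(1) e(1) by (intro exI[of _ "min d e / 2"]) auto
qed simp

end

section \<open>The set $C_A - x_0$ and its Minkowski functional\<close>

lemma C_shift_iff: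
  "v \<in> C_shift S \<phi> x0 A \<longleftrightarrow> x0 + v \<in> sublevel S \<phi> A \<and>
    (\<exists>\<alpha>>0. x0 + \<alpha> *\<^sub>R v \<in> sublevel S \<phi> A \<and> x0 - \<alpha> *\<^sub>R v \<in> sublevel S \<phi> A)"
proof -
  have "v \<in> C_shift S \<phi> x0 A \<longleftrightarrow> x0 + v \<in> C_set S \<phi> x0 A"
    unfolding C_shift_def by (force simp: image_iff algebra_simps)
  then show ?thesis by (simp add: C_set_def)
qed

lemma convex_sublevel:
  assumes "convex_on S \<phi>"
  shows "convex (sublevel S \<phi> A)"
proof (rule convexI)
  fix u v and s t :: real
  assume uv: "u \<in> sublevel S \<phi> A" "v \<in> sublevel S \<phi> A" and st: "0 \<le> s" "0 \<le> t" "s + t = 1"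
  have "s *\<^sub>R u + t *\<^sub>R v \<in> S"
    using convex_on_imp_convex[OF assms] uv st by (auto simp: sublevel_def convexD)
  moreover have "\<phi> (s *\<^sub>R u + t *\<^sub>R v) \<le> s * \<phi> u + t * \<phi> v"
    using assms uv st by (simp add: convex_on_def sublevel_def)
  moreover have "s * \<phi> u + t * \<phi> v \<le> A"
    using uv st by (intro convex_bound_le) (auto simp: sublevel_def)
  ultimately show "s *\<^sub>R u + t *\<^sub>R v \<in> sublevel S \<phi> A"
    by (simp add: sublevel_def)
qed

text \<open>Two points may come with different factors \<alpha>. As the sublevel set is convex and
  contains \<open>x0\<close>, both factors can be lowered to their minimum, and convex combinations
  are then taken with this common factor.\<close>

lemma convex_C_shift:
  assumes \<phi>: "convex_on S \<phi>" and x0: "x0 \<in> sublevel S \<phi> A"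
  shows "convex (C_shift S \<phi> x0 A)"
proof (rule convexI)
  let ?K = "C_shift S \<phi> x0 A" and ?M = "sublevel S \<phi> A"
  note M = convex_sublevel[OF \<phi>, of A]
  have shrink: "x0 + \<beta> *\<^sub>R w \<in> ?M" if "x0 + \<alpha> *\<^sub>R w \<in> ?M" "0 \<le> \<beta>" "\<beta> \<le> \<alpha>" "0 < \<alpha>" for \<alpha> \<beta> w
  proof -
    have "x0 + \<beta> *\<^sub>R w = (1 - \<beta> / \<alpha>) *\<^sub>R x0 + (\<beta> / \<alpha>) *\<^sub>R (x0 + \<alpha> *\<^sub>R w)"
      using that by (simp add: algebra_simps)
    also have "\<dots> \<in> ?M" using that x0 by (intro convexD[OF M]) auto
    finally show ?thesis .
  qed
  fix u v and s t :: real
  assume uv: "u \<in> ?K" "v \<in> ?K" and st: "0 \<le> s" "0 \<le> t" "s + t = 1"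
  \<comment> \<open>The factor \<open>r\<close> has arbitrary sign: it is used below with
    \<open>c\<close>, \<open>- c\<close> and 1.\<close>
  have comb: "x0 + r *\<^sub>R (s *\<^sub>R u + t *\<^sub>R v) \<in> ?M"
    if "x0 + r *\<^sub>R u \<in> ?M" "x0 + r *\<^sub>R v \<in> ?M" for r
  proof -
    have "x0 + r *\<^sub>R (s *\<^sub>R u + t *\<^sub>R v) = (s + t) *\<^sub>R x0 + r *\<^sub>R (s *\<^sub>R u + t *\<^sub>R v)"
      using st by simp
    also have "\<dots> = s *\<^sub>R (x0 + r *\<^sub>R u) + t *\<^sub>R (x0 + r *\<^sub>R v)"
      by (simp add: algebra_simps)
    also have "\<dots> \<in> ?M" using that st by (intro convexD[OF M])
    finally show ?thesis .
  qed
  obtain a b where a: "a > 0" "x0 + a *\<^sub>R u \<in> ?M" "x0 + a *\<^sub>R (- u) \<in> ?M"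
    and b: "b > 0" "x0 + b *\<^sub>R v \<in> ?M" "x0 + b *\<^sub>R (- v) \<in> ?M"
    using uv by (auto simp: C_shift_iff)
  define c where "c = min a b"
  have c: "0 < c" "c \<le> a" "c \<le> b" using a(1) b(1) by (auto simp: c_def)
  have "x0 + c *\<^sub>R (s *\<^sub>R u + t *\<^sub>R v) \<in> ?M"
    using comb shrink[OF a(2) _ c(2) a(1)] shrink[OF b(2) _ c(3) b(1)] c(1) by simp
  moreover have "x0 + (- c) *\<^sub>R (s *\<^sub>R u + t *\<^sub>R v) \<in> ?M"
    using comb[of "- c"] shrink[OF a(3) _ c(2) a(1)] shrink[OF b(3) _ c(3) b(1)] c(1) by simp
  moreover have "x0 + (s *\<^sub>R u + t *\<^sub>R v) \<in> ?M"
    using uv comb[of 1] by (simp add: C_shift_iff)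
  ultimately show "s *\<^sub>R u + t *\<^sub>R v \<in> ?K"
    using c(1) by (auto simp: C_shift_iff)
qed

lemma zero_in_C_shift: "x0 \<in> sublevel S \<phi> A \<Longrightarrow> 0 \<in> C_shift S \<phi> x0 A"
  by (auto simp: C_shift_iff intro: exI[of _ 1])

text \<open>Makes the results on directional derivatives available for directions in
  \<open>C_shift\<close> and in its span.\<close>

lemma C_shift_subset_span:
  assumes "x0 \<in> S"
  shows "C_shift S \<phi> x0 A \<subseteq> span {a - b |a b. a \<in> S \<and> b \<in> S}"
proof
  fix v assume "v \<in> C_shift S \<phi> x0 A"
  then have "x0 + v \<in> S" by (simp add: C_shift_iff sublevel_def)
  with assms have "(x0 + v) - x0 \<in> {a - b |a b. a \<in> S \<and> b \<in> S}" by blast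
  then show "v \<in> span {a - b |a b. a \<in> S \<and> b \<in> S}"
    by (simp add: span_base)
qed

text \<open>The positive multiples of \<open>K\<close> already form a subspace: convexity handles
  sums, symmetry handles negative factors. Hence the infimum defining the Minkowski functional runs
  over a non-empty set at every vector of the span.\<close>

lemma span_symmetric_convex:
  fixes K :: "'a::real_vector set"
  assumes K: "convex K" "0 \<in> K" "K = uminus ` K" and v: "v \<in> span K"
  obtains t k where "t > 0" "k \<in> K" "v = t *\<^sub>R k"
proof -
  let ?U = "{v. \<exists>t>0. \<exists>k\<in>K. v = t *\<^sub>R k}"
  have "subspace ?U"
  proof (rule subspaceI)
    show "0 \<in> ?U" using K(2) by (auto intro!: exI[of _ 1])
  next
    fix u w assume "u \<in> ?U" "w \<in> ?U"
    then obtain a k b l where ab: "a > 0" "k \<in> K" "u = a *\<^sub>R k" "b > 0" "l \<in> K" "w = b *\<^sub>R l"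
      by blast
    \<comment> \<open>A sum of multiples with factors \<open>a\<close> and \<open>b\<close> is
      \<open>a + b\<close> times a convex combination.\<close>
    have "(a / (a + b)) *\<^sub>R k + (b / (a + b)) *\<^sub>R l \<in> K"
      using ab add_pos_pos[of a b] by (intro convexD[OF K(1)]) (auto simp flip: add_divide_distrib)
    moreover have "u + w = (a + b) *\<^sub>R ((a / (a + b)) *\<^sub>R k + (b / (a + b)) *\<^sub>R l)"
      using ab by (simp add: scaleR_right_distrib)
    ultimately show "u + w \<in> ?U"
      using ab(1,4) by (intro CollectI exI[of _ "a + b"]) auto
  next
    fix c :: real and u assume "u \<in> ?U"
    then obtain a k where a: "a > 0" "k \<in> K" "u = a *\<^sub>R k" by blast
    consider "c > 0" | "c = 0" | "c < 0" by linarith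
    then show "c *\<^sub>R u \<in> ?U"
    proof cases
      case 1
      then show ?thesis using a by (intro CollectI exI[of _ "c * a"]) auto
    next
      case 2
      then show ?thesis using K(2) by (auto intro!: exI[of _ 1])
    next
      case 3
      have "- k \<in> K" using a(2) K(3) by auto
      then show ?thesis using a 3
        by (intro CollectI exI[of _ "- c * a"]) (auto simp: mult_neg_pos intro!: bexI[of _ "- k"])
    qed
  qed
  moreover have "K \<subseteq> ?U" by (auto intro!: exI[of _ 1])
  ultimately have "span K \<subseteq> ?U" by (rule span_minimal[rotated])
  then show thesis using v that by blast
qed

section \<open>Elementary properties of the Minkowski functional\<close>

lemma minkowski_functional_zero:
  assumes "0 \<in> K"
  shows "minkowski_functional K 0 = 0"
proof -
  have "{t. t > 0 \<and> 0 \<in> (\<lambda>k. t *\<^sub>R k) ` K} = {0<..}"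
    using assms by (force simp: image_iff)
  then show ?thesis by (simp add: minkowski_functional_def)
qed

lemma minkowski_functional_minus:
  assumes "K = uminus ` K"
  shows "minkowski_functional K (- v) = minkowski_functional K v"
proof -
  have "- v \<in> (\<lambda>k. t *\<^sub>R k) ` K \<longleftrightarrow> v \<in> (\<lambda>k. t *\<^sub>R k) ` K" for t
  proof -
    have neg: "- k \<in> K" if "k \<in> K" for k using that assms by auto
    show ?thesis
    proof
      assume "- v \<in> (\<lambda>k. t *\<^sub>R k) ` K"
      then obtain k where "k \<in> K" "- v = t *\<^sub>R k" by blast
      then have "- k \<in> K" "v = t *\<^sub>R (- k)" using neg by (auto simp flip: \<open>- v = t *\<^sub>R k\<close>)
      then show "v \<in> (\<lambda>k. t *\<^sub>R k) ` K" by blast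
    next
      assume "v \<in> (\<lambda>k. t *\<^sub>R k) ` K"
      then obtain k where "k \<in> K" "v = t *\<^sub>R k" by blast
      then have "- k \<in> K" "- v = t *\<^sub>R (- k)" using neg by auto
      then show "- v \<in> (\<lambda>k. t *\<^sub>R k) ` K" by blast
    qed
  qed
  then show ?thesis by (simp add: minkowski_functional_def)
qed

text \<open>The representation \<open>v = s *\<^sub>R k\<close> guards against the infimum of the
  empty set, about which nothing could be concluded.\<close>

lemma le_minkowski_functional:
  assumes "v = s *\<^sub>R k" "s > 0" "k \<in> K"
    and "\<And>t k. t > 0 \<Longrightarrow> k \<in> K \<Longrightarrow> v = t *\<^sub>R k \<Longrightarrow> c \<le> t"
  shows "c \<le> minkowski_functional K v"
  unfolding minkowski_functional_def
  using assms by (intro cInf_greatest) auto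

text \<open>A bound \<open>L\<close> valid on all of \<open>C_shift\<close> spreads by homogeneity:
  \<open>v = t *\<^sub>R k\<close> gives at most \<open>t * L\<close>, and the infimum over such
  \<open>t\<close> is the Minkowski functional.\<close>

lemma dir_deriv_le_minkowski_functional:
  assumes S: "convex S" and \<phi>: "convex_on S \<phi>" and x: "x \<in> icr S"
    and x0: "x0 \<in> sublevel S \<phi> A"
    and sym: "C_shift S \<phi> x0 A = uminus ` C_shift S \<phi> x0 A"
  obtains L where "L > 0"
    "\<And>v. v \<in> X_space S \<phi> x0 A \<Longrightarrow> dir_deriv \<phi> x v \<le> L * minkowski_functional (C_shift S \<phi> x0 A) v"
proof -
  let ?K = "C_shift S \<phi> x0 A" and ?D = "span {a - b |a b. a \<in> S \<and> b \<in> S}"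
  have mem: "x \<in> S" "x0 \<in> S" using x x0 by (auto simp: icr_def sublevel_def)
  then have "x - x0 \<in> ?D" by (intro span_base) blast
  \<comment> \<open>The segment from \<open>x0\<close> to \<open>x\<close> can be prolonged beyond
    \<open>x\<close> inside \<open>S\<close>.\<close>
  then obtain t where t: "t > 0" "x + t *\<^sub>R (x - x0) \<in> S"
    using x by (auto simp: icr_def)
  define z where "z = x + t *\<^sub>R (x - x0)"
  \<comment> \<open>This weight satisfies \<open>x = (1 - l) *\<^sub>R z + l *\<^sub>R x0\<close>,
    so replacing \<open>x0\<close> by \<open>x0 + k\<close> moves \<open>x\<close> by
    \<open>l *\<^sub>R k\<close>.\<close>
  define l where "l = t / (1 + t)"
  have l: "0 < l" "l \<le> 1" "(1 - l) * t = l"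
    using t by (auto simp: l_def field_simps)
  define B where "B = (1 - l) * \<phi> z + l * A - \<phi> x"
  \<comment> \<open>The summand 1 keeps \<open>L\<close> positive even if \<open>B\<close> is zero,
    which permits division by \<open>L\<close>.\<close>
  define L where "L = \<bar>B\<bar> / l + 1"
  have "L > 0" using l by (simp add: L_def add_nonneg_pos)
  have K: "dir_deriv \<phi> x k \<le> L" if "k \<in> ?K" for k
  proof -
    have k: "x0 + k \<in> S" "\<phi> (x0 + k) \<le> A"
      using that by (auto simp: C_shift_iff sublevel_def)
    have "(1 - l) *\<^sub>R z + l *\<^sub>R (x0 + k) = x + l *\<^sub>R k + ((1 - l) * t - l) *\<^sub>R (x - x0)"
      by (simp add: z_def algebra_simps)
    then have eq: "x + l *\<^sub>R k = (1 - l) *\<^sub>R z + l *\<^sub>R (x0 + k)"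
      using l(3) by simp
    have zS: "z \<in> S" using t by (simp add: z_def)
    have xl: "x + l *\<^sub>R k \<in> S"
      unfolding eq using l zS k by (intro convexD[OF S]) auto
    have "\<phi> (x + l *\<^sub>R k) \<le> (1 - l) * \<phi> z + l * \<phi> (x0 + k)"
      unfolding eq using l zS k by (intro convex_onD[OF \<phi>]) auto
    also have "\<dots> \<le> (1 - l) * \<phi> z + l * A"
      using l k by (intro add_left_mono mult_left_mono) auto
    finally have "\<phi> (x + l *\<^sub>R k) - \<phi> x \<le> \<bar>B\<bar>" by (simp add: B_def)
    then have "(\<phi> (x + l *\<^sub>R k) - \<phi> x) / l \<le> \<bar>B\<bar> / l"
      using l by (intro divide_right_mono) auto
    moreover have "dir_deriv \<phi> x k \<le> (\<phi> (x + l *\<^sub>R k) - \<phi> x) / l"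
      using C_shift_subset_span[OF mem(2)] that l xl
      by (intro difference_quotient_tendsto_dir_deriv(2)[OF S \<phi> x]) auto
    ultimately show ?thesis by (simp add: L_def)
  qed
  have "dir_deriv \<phi> x v \<le> L * minkowski_functional ?K v" if v: "v \<in> X_space S \<phi> x0 A" for v
  proof -
    obtain s k where sk: "s > 0" "k \<in> ?K" "v = s *\<^sub>R k"
      using span_symmetric_convex[OF convex_C_shift[OF \<phi> x0] zero_in_C_shift[OF x0] sym] v
      by (auto simp: X_space_def)
    have "dir_deriv \<phi> x v / L \<le> minkowski_functional ?K v"
    proof (rule le_minkowski_functional[OF sk(3,1,2)])
      fix t k assume tk: "t > 0" "k \<in> ?K" "v = t *\<^sub>R k"
      have "k \<in> ?D" using tk(2) C_shift_subset_span[OF mem(2)] by blast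
      then have "dir_deriv \<phi> x v = t * dir_deriv \<phi> x k"
        using tk dir_deriv_scale[OF S \<phi> x] by simp
      also have "\<dots> \<le> t * L" using K tk by simp
      finally show "dir_deriv \<phi> x v / L \<le> t" using \<open>L > 0\<close> by (simp add: field_simps)
    qed
    then show ?thesis using \<open>L > 0\<close> by (simp add: field_simps)
  qed
  with \<open>L > 0\<close> show thesis by (rule that)
qed

section \<open>Continuity and compactness\<close>

lemma algebraic_dual_diff:
  assumes "subspace V" "\<zeta> \<in> algebraic_dual V" "u \<in> V" "v \<in> V"
  shows "\<zeta> (u - v) = \<zeta> u - \<zeta> v"
proof -
  have "\<zeta> (u - v + v) = \<zeta> (u - v) + \<zeta> v"
    using assms subspace_diff[OF assms(1,3,4)] unfolding algebraic_dual_def by blast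
  then show ?thesis by simp
qed

lemma algebraic_dual_minus:
  assumes "\<zeta> \<in> algebraic_dual V" "v \<in> V"
  shows "\<zeta> (- v) = - \<zeta> v"
proof -
  have "\<zeta> ((- 1) *\<^sub>R v) = - 1 * \<zeta> v"
    using assms unfolding algebraic_dual_def by blast
  then show ?thesis by simp
qed

lemma vector_topology_translation:
  assumes "vector_topology_on V T" "v \<in> V"
  shows "continuous_map T T (\<lambda>w. w - v)"
proof -
  from assms have V: "subspace V" "topspace T = V"
    and add: "continuous_map (prod_topology T T) T (\<lambda>(u, v). u + v)"
    by (auto simp: vector_topology_on_def)
  have "continuous_map T (prod_topology T T) (\<lambda>w. (w, - v))"
    using V assms(2) by (intro continuous_map_pairedI) (auto simp: subspace_neg)
  from continuous_map_compose[OF this add] show ?thesis by (simp add: o_def)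
qed

text \<open>Linearity gives \<open>\<bar>\<zeta> w - \<zeta> v\<bar> \<le> m (w - v)\<close>, and
  the right-hand side is continuous in \<open>w\<close> and vanishes at \<open>v\<close>.\<close>

lemma dominated_functional_continuous:
  assumes T: "vector_topology_on V T" and \<zeta>: "\<zeta> \<in> algebraic_dual V"
    and m: "continuous_map T euclideanreal m" "m 0 = 0"
    and dom: "\<And>v. v \<in> V \<Longrightarrow> \<bar>\<zeta> v\<bar> \<le> m v"
  shows "continuous_map T euclideanreal \<zeta>"
proof -
  have V: "subspace V" "topspace T = V" using T by (auto simp: vector_topology_on_def)
  show ?thesis
    unfolding continuous_map_eq_topcontinuous_at topcontinuous_at_def
  proof (intro ballI allI impI conjI)
    fix v W assume "v \<in> topspace T" and W: "openin euclideanreal W \<and> \<zeta> v \<in> W"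
    obtain e where e: "0 < e" "ball (\<zeta> v) e \<subseteq> W"
      using W by (auto elim: openE)
    have v: "v \<in> V" using V \<open>v \<in> topspace T\<close> by simp
    have cont: "continuous_map T euclideanreal (\<lambda>w. m (w - v))"
      using continuous_map_compose[OF vector_topology_translation[OF T v] m(1)] by (simp add: o_def)
    let ?U = "{w \<in> topspace T. m (w - v) \<in> {..<e}}"
    have "openin T ?U"
      by (rule openin_continuous_map_preimage[OF cont]) simp
    moreover have "v \<in> ?U" using v V m(2) e(1) by simp
    moreover have "dist (\<zeta> v) (\<zeta> w) < e" if "w \<in> ?U" for w
      using that dom[of "w - v"] V v algebraic_dual_diff[OF V(1) \<zeta>, of w v]
      by (auto simp: dist_real_def subspace_diff abs_minus_commute)
    ultimately show "\<exists>U. openin T U \<and> v \<in> U \<and> (\<forall>w\<in>U. \<zeta> w \<in> W)"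
      using e(2) by (intro exI[of _ ?U]) (auto simp: subset_iff)
  qed auto
qed

text \<open>Each linearity or domination condition involves finitely many coordinates, which depend
  continuously on the functional; the set is an intersection of closed preimages.\<close>

lemma closedin_dominated_functionals:
  assumes V: "subspace V"
  shows "closedin (product_topology (\<lambda>_. euclideanreal) V)
           {\<zeta> \<in> algebraic_dual V. \<forall>v\<in>V. \<zeta> v \<le> p v}"
    (is "closedin ?P ?M")
proof -
  have proj: "continuous_map ?P euclideanreal (\<lambda>f. f v)" if "v \<in> V" for v
    using that by (rule continuous_map_product_projection)
  define F where "F =
     (\<lambda>(u, v). {f \<in> topspace ?P. f (u + v) - (f u + f v) \<in> {0}}) ` (V \<times> V) \<union>
     (\<lambda>(c, v). {f \<in> topspace ?P. f (c *\<^sub>R v) - c * f v \<in> {0}}) ` (UNIV \<times> V) \<union>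
     (\<lambda>v. {f \<in> topspace ?P. f v \<in> {..p v}}) ` V"
  \<comment> \<open>Non-emptiness keeps the intersection inside the product space; extensionality
    comes from membership in that space.\<close>
  have "F \<noteq> {}" using subspace_0[OF V] by (auto simp: F_def)
  moreover have "closedin ?P Z" if "Z \<in> F" for Z
  proof -
    have "closedin ?P {f \<in> topspace ?P. f (u + v) - (f u + f v) \<in> {0}}" if "u \<in> V" "v \<in> V" for u v
      using that by (intro closedin_continuous_map_preimage[of _ euclideanreal]
          continuous_map_diff continuous_map_add proj subspace_add[OF V]) auto
    moreover have "closedin ?P {f \<in> topspace ?P. f (c *\<^sub>R v) - c * f v \<in> {0}}" if "v \<in> V" for c v
      using that by (intro closedin_continuous_map_preimage[of _ euclideanreal]
          continuous_map_diff continuous_map_real_mult_left proj subspace_scale[OF V]) auto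
    moreover have "closedin ?P {f \<in> topspace ?P. f v \<in> {..p v}}" if "v \<in> V" for v
      using that by (intro closedin_continuous_map_preimage[of _ euclideanreal] proj) auto
    ultimately show ?thesis
      using that unfolding F_def by (elim UnE imageE SigmaE) (simp_all only: case_prod_conv)
  qed
  moreover have "?M = \<Inter> F"
    using subspace_0[OF V]
    by (auto simp: F_def algebraic_dual_def PiE_UNIV_domain PiE_iff)
  ultimately show ?thesis by auto
qed

text \<open>The two-sided bound places the closed set inside a product of compact intervals.\<close>

lemma compactin_dominated_functionals:
  assumes V: "subspace V"
    and low: "\<And>\<zeta> v. \<zeta> \<in> algebraic_dual V \<Longrightarrow> (\<forall>v\<in>V. \<zeta> v \<le> p v) \<Longrightarrow> v \<in> V \<Longrightarrow> \<bar>\<zeta> v\<bar> \<le> m v"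
  shows "compactin (product_topology (\<lambda>_. euclideanreal) V)
           {\<zeta> \<in> algebraic_dual V. \<forall>v\<in>V. \<zeta> v \<le> p v}"
proof (rule closed_compactin[OF _ _ closedin_dominated_functionals[OF V]])
  show "compactin (product_topology (\<lambda>_. euclideanreal) V) (PiE V (\<lambda>v. {- m v..m v}))"
    by (simp add: compactin_PiE)
  show "{\<zeta> \<in> algebraic_dual V. \<forall>v\<in>V. \<zeta> v \<le> p v} \<subseteq> PiE V (\<lambda>v. {- m v..m v})"
  proof
    fix \<zeta> assume "\<zeta> \<in> {\<zeta> \<in> algebraic_dual V. \<forall>v\<in>V. \<zeta> v \<le> p v}"
    then have \<zeta>: "\<zeta> \<in> algebraic_dual V" "\<forall>v\<in>V. \<zeta> v \<le> p v" by auto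
    have "\<zeta> v \<in> {- m v..m v}" if "v \<in> V" for v
      using low[OF \<zeta> that] by (simp add: abs_le_iff)
    with \<zeta>(1) show "\<zeta> \<in> PiE V (\<lambda>v. {- m v..m v})"
      by (simp add: PiE_iff algebraic_dual_def)
  qed
qed

lemma convex_functionals_dominated:
  assumes V: "subspace V"
  shows "convex_functionals V {\<zeta> \<in> algebraic_dual V. \<forall>v\<in>V. \<zeta> v \<le> p v}"
  unfolding convex_functionals_def
proof (intro ballI allI impI CollectI conjI)
  fix \<zeta> \<eta> and s t :: real
  assume \<zeta>: "\<zeta> \<in> {\<zeta> \<in> algebraic_dual V. \<forall>v\<in>V. \<zeta> v \<le> p v}"
    and \<eta>: "\<eta> \<in> {\<zeta> \<in> algebraic_dual V. \<forall>v\<in>V. \<zeta> v \<le> p v}"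
    and st: "0 \<le> s" "0 \<le> t" "s + t = 1"
  show "(\<lambda>v\<in>V. s * \<zeta> v + t * \<eta> v) \<in> algebraic_dual V"
    using \<zeta> \<eta> V by (auto simp: algebraic_dual_def subspace_add subspace_scale algebra_simps)
  fix v assume "v \<in> V"
  then show "(\<lambda>v\<in>V. s * \<zeta> v + t * \<eta> v) v \<le> p v"
    using \<zeta> \<eta> st by (auto intro: convex_bound_le)
qed

theorem proposition4p3:
  fixes S :: "'a::real_vector set" and \<phi> :: "'a \<Rightarrow> real" and x0 :: 'a and A :: real
  assumes "convex S"
    and "icr S \<noteq> {}"
    and "convex_on S \<phi>"
    and "x0 \<in> icr S"
    and "A \<ge> \<phi> x0"
    and "C_shift S \<phi> x0 A = uminus ` C_shift S \<phi> x0 A"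
  shows "(\<forall>x \<in> icr S. mu_subdifferential S \<phi> x0 A x \<noteq> {} \<and>
            convex_functionals (X_space S \<phi> x0 A) (mu_subdifferential S \<phi> x0 A x)) \<and>
         (\<forall>T. vector_topology_on (X_space S \<phi> x0 A) T \<and>
              continuous_map T euclideanreal (minkowski_functional (C_shift S \<phi> x0 A)) \<longrightarrow>
            (\<forall>x \<in> icr S. mu_subdifferential S \<phi> x0 A x \<subseteq> topological_dual T \<and>
               compactin (weak_star_topology T) (mu_subdifferential S \<phi> x0 A x)))"
proof -
  let ?K = "C_shift S \<phi> x0 A" and ?V = "X_space S \<phi> x0 A"
  let ?\<mu> = "minkowski_functional ?K"
  have x0: "x0 \<in> sublevel S \<phi> A" "x0 \<in> S"
    using assms(4,5) by (auto simp: icr_def sublevel_def)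
  have V: "subspace ?V" by (simp add: X_space_def)
  \<comment> \<open>On this subspace the directional derivative is therefore sublinear.\<close>
  have VD: "?V \<subseteq> span {a - b |a b. a \<in> S \<and> b \<in> S}"
    unfolding X_space_def by (rule span_minimal[OF C_shift_subset_span[OF x0(2)]]) simp
  have "mu_subdifferential S \<phi> x0 A x \<noteq> {}" if x: "x \<in> icr S" for x
  proof -
    obtain \<zeta> where "\<zeta> \<in> algebraic_dual ?V" "\<And>v. v \<in> ?V \<Longrightarrow> \<zeta> v \<le> dir_deriv \<phi> x v"
    proof (rule sublinear_on_dominates_functional[OF V, of "dir_deriv \<phi> x"])
      show "dir_deriv \<phi> x (u + v) \<le> dir_deriv \<phi> x u + dir_deriv \<phi> x v"
        if "u \<in> ?V" "v \<in> ?V" for u v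
        using that VD by (intro dir_deriv_add_le[OF assms(1,3) x]) auto
      show "dir_deriv \<phi> x (t *\<^sub>R v) = t * dir_deriv \<phi> x v" if "t > 0" "v \<in> ?V" for t v
        using that VD by (intro dir_deriv_scale[OF assms(1,3) x]) auto
    qed blast
    then show ?thesis by (auto simp: mu_subdifferential_def)
  qed
  moreover have "convex_functionals ?V (mu_subdifferential S \<phi> x0 A x)" for x
    unfolding mu_subdifferential_def by (rule convex_functionals_dominated[OF V])
  moreover have "mu_subdifferential S \<phi> x0 A x \<subseteq> topological_dual T \<and>
      compactin (weak_star_topology T) (mu_subdifferential S \<phi> x0 A x)"
    if T: "vector_topology_on ?V T" and \<mu>: "continuous_map T euclideanreal ?\<mu>"
      and x: "x \<in> icr S" for T x
  proof -
    have top: "topspace T = ?V" using T by (simp add: vector_topology_on_def)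
    obtain L where L: "L > 0" "\<And>v. v \<in> ?V \<Longrightarrow> dir_deriv \<phi> x v \<le> L * ?\<mu> v"
      using dir_deriv_le_minkowski_functional[OF assms(1,3) x x0(1) assms(6)] by blast
    \<comment> \<open>Domination is used at \<open>v\<close> and at \<open>- v\<close>; symmetry of
      \<open>C_shift\<close> makes \<mu> even, so the one-sided bound becomes two-sided.\<close>
    have bound: "\<bar>\<zeta> v\<bar> \<le> L * ?\<mu> v"
      if \<zeta>: "\<zeta> \<in> algebraic_dual ?V" "\<forall>v\<in>?V. \<zeta> v \<le> dir_deriv \<phi> x v" and v: "v \<in> ?V" for \<zeta> v
    proof -
      have "- v \<in> ?V" using subspace_neg[OF V v] .
      then have "\<zeta> (- v) \<le> L * ?\<mu> (- v)" using \<zeta>(2) L(2) by (meson order_trans)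
      then have "- \<zeta> v \<le> L * ?\<mu> v"
        by (simp only: minkowski_functional_minus[OF assms(6)] algebraic_dual_minus[OF \<zeta>(1) v])
      moreover have "\<zeta> v \<le> L * ?\<mu> v" using \<zeta>(2) L(2) v by (meson order_trans)
      ultimately show ?thesis by simp
    qed
    have sub: "mu_subdifferential S \<phi> x0 A x \<subseteq> topological_dual T"
    proof
      fix \<zeta> assume "\<zeta> \<in> mu_subdifferential S \<phi> x0 A x"
      then have \<zeta>: "\<zeta> \<in> algebraic_dual ?V" "\<forall>v\<in>?V. \<zeta> v \<le> dir_deriv \<phi> x v"
        by (auto simp: mu_subdifferential_def)
      have "continuous_map T euclideanreal \<zeta>"
        using minkowski_functional_zero[OF zero_in_C_shift[OF x0(1)]] bound[OF \<zeta>]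
        by (intro dominated_functional_continuous[OF T \<zeta>(1), of "\<lambda>v. L * ?\<mu> v"]
            continuous_map_real_mult continuous_map_const[THEN iffD2] \<mu>) auto
      with \<zeta>(1) show "\<zeta> \<in> topological_dual T" by (simp add: topological_dual_def top)
    qed
    \<comment> \<open>Compactness is shown in the full product; the inclusion \<open>sub\<close>
      transfers it to the subspace topology on the topological dual.\<close>
    moreover have "compactin (product_topology (\<lambda>_. euclideanreal) ?V) (mu_subdifferential S \<phi> x0 A x)"
      unfolding mu_subdifferential_def
      using bound by (rule compactin_dominated_functionals[OF V])
    ultimately show ?thesis
      by (simp add: weak_star_topology_def compactin_subtopology top)
  qed
  ultimately show ?thesis by blast
qed

end
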